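(* Let $q$ be a prime power and let $\ell, m$ be integers with $0 < \ell < m$. Let $(\bm{A}, \bm{B}, \pi)$ be the output of $\mathsf{GenPKP}(q,\ell,m,1)$, i.e.\ $\pi$ is uniformly random in $\mathbb{S}_m$, $\bm{B}$ is uniformly random in $\mathbb{F}_q^{m \times 1, 1}$ (independent of $\pi$), and, given $(\pi,\bm{B})$, $\bm{A}$ is uniformly random among the matrices in $\mathbb{F}_q^{\ell \times m, \ell}$ satisfying $\bm{A}\bm{\pi}\bm{B} = \bm{0}$. Then \[ \mathbb{E}[N_{\mathsf{sol}}(\bm{A}, \bm{B})] = \frac{m!(q^{m-\ell} - q)}{q^m - q} + \frac{m!(q^m - q^{m - \ell})}{(q^m - 1)(q^m - q)}\left(\sum_{d \mid q - 1} \varphi(d) \binom{\lfloor (q+m-1) / d\rfloor}{\lfloor m / d\rfloor} - q + 1\right). \]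
   Context: $\mathbb{F}_q$ is the finite field with $q$ elements. $\mathbb{F}_q^{a \times b, r}$ denotes the set of $a\times b$ matrices over $\mathbb{F}_q$ of rank exactly $r$ (so $\mathbb{F}_q^{m\times 1,1}$ is the set of nonzero column vectors of length $m$). $\mathbb{S}_m$ is the symmetric group on $\{1,\dots,m\}$; for $\pi\in\mathbb{S}_m$, $\bm{\pi}$ is the $m\times m$ permutation matrix with $(i,j)$ entry $\delta_{\pi(i),j}$. $N_{\mathsf{sol}}(\bm{A},\bm{B})$ is the number of $\rho\in\mathbb{S}_m$ with $\bm{A}\bm{\rho}\bm{B}=\bm{0}$. $\varphi$ is Euler's totient function and the sum runs over positive divisors $d$ of $q-1$. *)

theory Defs
  imports
    "HOL-Probability.Probability_Mass_Function"
    "HOL-Number_Theory.Totient"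
    "HOL-Combinatorics.Permutations"
    "Jordan_Normal_Form.DL_Rank"
begin

text \<open>
  \<open>\<bbbF>\<^sub>q\<close> is an arbitrary finite field type \<open>'a\<close> with \<open>CARD('a) = q\<close>. Row and column indices are
  counted from \<open>0\<close>, so the symmetric group \<open>\<bbbS>\<^sub>m\<close> acts on \<open>{0..<m}\<close>; its elements are
  total functions on \<open>nat\<close> that fix every number outside that set.
\<close>

definition rank_mats :: "nat \<Rightarrow> nat \<Rightarrow> nat \<Rightarrow> 'a::field mat set" where
  "rank_mats a b r = {M \<in> carrier_mat a b. vec_space.rank a M = r}"

definition sym_group :: "nat \<Rightarrow> (nat \<Rightarrow> nat) set" where
  "sym_group m = {\<pi>. \<pi> permutes {0..<m}}"

definition permutation_mat :: "nat \<Rightarrow> (nat \<Rightarrow> nat) \<Rightarrow> 'a::field mat" where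
  "permutation_mat m \<pi> = Matrix.mat m m (\<lambda>(i, j). if \<pi> i = j then 1 else 0)"

definition N_sol :: "'a::field mat \<Rightarrow> 'a mat \<Rightarrow> nat" where
  "N_sol A B = card {\<rho> \<in> sym_group (dim_col A).
     A * permutation_mat (dim_col A) \<rho> * B = 0\<^sub>m (dim_row A) (dim_col B)}"

text \<open>
  The sets sampled from are finite, and they are nonempty whenever \<open>l + n \<le> m\<close>; outside that range
  the uniform distributions, and hence \<open>GenPKP\<close>, may be unspecified.
\<close>

definition GenPKP ::
  "nat \<Rightarrow> nat \<Rightarrow> nat \<Rightarrow> ('a::{field, finite} mat \<times> 'a mat \<times> (nat \<Rightarrow> nat)) pmf" where
  "GenPKP l m n =
     bind_pmf (pmf_of_set (sym_group m)) (\<lambda>\<pi>.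
     bind_pmf (pmf_of_set (rank_mats m n n)) (\<lambda>B.
     bind_pmf (pmf_of_set {A \<in> rank_mats l m l. A * permutation_mat m \<pi> * B = 0\<^sub>m l n}) (\<lambda>A.
     return_pmf (A, B, \<pi>))))"

end

theory Submission
  imports Defs "HOL-Algebra.Multiplicative_Group" "HOL-Combinatorics.Multiset_Permutations"
begin

text \<open>
  Fix \<open>\<pi>\<close> and \<open>b\<close>. A permutation \<open>\<rho>\<close> with \<open>\<rho>b\<close> parallel to \<open>\<pi>b\<close> is always a solution. Any other \<open>\<rho>\<close>
  is a solution with probability \<open>p = (q^(m-l) - q) / (q^m - q)\<close>: shears fixing \<open>\<pi>b\<close> act transitively on the
  vectors off its line, and each \<open>A\<close> kills \<open>q^(m-l) - q\<close> of these. It remains to count the pairs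
  \<open>(\<rho>, b)\<close> with \<open>\<rho>b = cb\<close> for a given scalar \<open>c \<noteq> 0\<close>. By orbit counting, each multiset of entries of
  size \<open>m\<close> that is invariant under multiplication by \<open>c\<close> contributes \<open>m!\<close> such pairs. If \<open>c\<close> has order
  \<open>d\<close>, an invariant multiset amounts to a multiplicity for each of the \<open>(q - 1) / d\<close> cosets of \<open>\<langle>c\<rangle>\<close>, with
  total at most \<open>\<lfloor>m / d\<rfloor>\<close>, the rest being zeros; since the multiplicative group is cyclic,
  \<open>\<phi>(d)\<close> scalars have order \<open>d\<close>.
\<close>

unbundle no vec_syntax and no inner_syntax

subsection \<open>Multisets invariant under multiplication\<close>

text \<open>Cyclicity of the multiplicative group, carried over from \<open>class_ring\<close> to
  the power operation of the type class. Exponents below \<open>CARD('a) - 1\<close> give discrete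
  logarithms.\<close>

lemma finite_field_generator:
  obtains g :: "'a::{field, finite}"
  where "bij_betw (\<lambda>i. g ^ i) {..<CARD('a) - 1} (UNIV - {0})" "g ^ (CARD('a) - 1) = 1"
proof -
  define N where "N = CARD('a) - 1"
  let ?R = "class_ring :: 'a ring"
  have [simp]: "carrier (mult_of ?R) = UNIV - {0}"
    by (auto simp: mult_of_def)
  have pow: "x [^]\<^bsub>mult_of ?R\<^esub> n = x ^ n" for x :: 'a and n :: nat
    by (induction n) (auto simp: mult_of_def nat_pow_def)
  interpret G: group "mult_of ?R" by (rule field.field_mult_group[OF class_field])
  have fin: "finite (carrier ?R)" by simp
  obtain g where g: "g \<in> carrier (mult_of ?R)"
    "carrier (mult_of ?R) = {g [^]\<^bsub>?R\<^esub> i | i::nat. i \<in> UNIV}"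
    using field.finite_field_mult_group_has_gen[OF class_field fin] by blast
  have powR: "x [^]\<^bsub>?R\<^esub> n = x ^ n" for x :: 'a and n :: nat
    by (induction n) (auto simp: nat_pow_def)
  have sur: "UNIV - {0} = range (\<lambda>i. g ^ i)"
    using g(2) by (simp only: powR) auto
  have cardN: "card (UNIV - {0::'a}) = N" by (simp add: N_def)
  have one: "g ^ N = 1"
  proof -
    have "order (mult_of ?R) = N" by (simp add: order_def N_def)
    moreover have "\<one>\<^bsub>mult_of ?R\<^esub> = 1" by (simp add: mult_of_def)
    ultimately show ?thesis using G.pow_order_eq_1[OF g(1)] by (simp only: pow)
  qed
  have "CARD('a) > 1"
    using card_mono[of UNIV "{0::'a, 1}"] by simp
  hence Npos: "N > 0" by (simp add: N_def)
  \<comment> \<open>Exponents may be reduced modulo \<open>N\<close>, so the first \<open>N\<close>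
    powers already reach every nonzero element; equal cardinalities then force injectivity.\<close>
  have "(\<lambda>i. g ^ i) ` {..<N} = range (\<lambda>i. g ^ i)"
  proof safe
    fix i
    have "g ^ i = g ^ (N * (i div N) + i mod N)" by simp
    also have "\<dots> = g ^ (i mod N)" by (simp only: power_add power_mult one) simp
    finally show "g ^ i \<in> (\<lambda>i. g ^ i) ` {..<N}" using Npos by auto
  qed auto
  hence img: "(\<lambda>i. g ^ i) ` {..<N} = UNIV - {0}" using sur by simp
  have "inj_on (\<lambda>i. g ^ i) {..<N}"
    by (rule eq_card_imp_inj_on) (auto simp: img cardN)
  with img one that show thesis unfolding bij_betw_def N_def by blast
qed

text \<open>By Bezout, \<open>gcd k N\<close> is the difference of a multiple of \<open>k\<close>
  and a multiple of \<open>N\<close>, hence itself a period.\<close>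

lemma periodic_gcd:
  fixes h :: "nat \<Rightarrow> 'b"
  assumes k: "\<And>i. h (i + k) = h i" and N: "\<And>i. h (i + N) = h i" and "k > 0"
  shows "h (i mod gcd k N) = h i"
proof -
  have mult: "h (i + a * b) = h i" if "\<And>i. h (i + a) = h i" for a b i
  proof (induction b)
    case (Suc b)
    have "h (i + a * Suc b) = h ((i + a * b) + a)" by (simp add: algebra_simps)
    thus ?case using Suc that[of "i + a * b"] by simp
  qed simp
  obtain x y where xy: "k * x = N * y + gcd k N" using bezout_nat[of k N] \<open>k > 0\<close> by auto
  have e: "h (i + gcd k N) = h i" for i
    using mult[OF N, of "i + gcd k N" y] mult[OF k, of i x] by (simp add: xy add_ac)
  show ?thesis using mult[OF e, of "i mod gcd k N" "i div gcd k N"] by simp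
qed

lemma sum_periodic:
  fixes f :: "nat \<Rightarrow> nat"
  shows "(\<Sum>i<e * d. f (i mod e)) = d * (\<Sum>i<e. f i)"
proof (induction d)
  case (Suc d)
  have "(\<Sum>i<e * Suc d. f (i mod e)) = (\<Sum>i<e * d. f (i mod e)) + (\<Sum>i=e*d..<e*d+e. f (i mod e))"
    using sum.atLeastLessThan_concat[of 0 "e*d" "e*d+e" "\<lambda>i. f (i mod e)"]
    by (simp add: atLeast0LessThan add.commute)
  also have "(\<Sum>i=e*d..<e*d+e. f (i mod e)) = (\<Sum>i<e. f i)"
    using sum.shift_bounds_nat_ivl[of "\<lambda>i. f (i mod e)" 0 "e*d" e]
    by (simp add: atLeast0LessThan add.commute)
  finally show ?case using Suc by simp
qed simp

text \<open>Prepending the slack \<open>s - sum_list l\<close> turns the bound into an exact sum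
  with one more entry, which stars and bars counts.\<close>

lemma card_lists_sum_list_le:
  "card {l::nat list. length l = e \<and> sum_list l \<le> s} = (s + e) choose s"
proof -
  have "bij_betw tl {l::nat list. length l = Suc e \<and> sum_list l = s} {l. length l = e \<and> sum_list l \<le> s}"
    by (rule bij_betw_byWitness[where f' = "\<lambda>l. (s - sum_list l) # l"])
       (auto simp: length_Suc_conv)
  from bij_betw_same_card[OF this] show ?thesis
    using card_length_sum_list[of "Suc e" s] by simp
qed

text \<open>The powers of \<open>g ^ k\<close> are those of \<open>g ^ e\<close>, so invariance says
  that the multiplicity of a nonzero element depends only on its logarithm modulo \<open>e\<close>.
  Each of these \<open>e\<close> free multiplicities counts for a coset of
  \<open>d = N div e\<close> elements, and zeros fill up the size to \<open>m\<close>; the choices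
  are therefore lists of length \<open>e\<close> with sum at most \<open>m div d\<close>.\<close>

lemma card_invariant_multisets:
  fixes g :: "'a::{field, finite}"
  defines "N \<equiv> CARD('a) - 1"
  assumes bij: "bij_betw (\<lambda>i. g ^ i) {..<N} (UNIV - {0})" and one: "g ^ N = 1"
    and k: "0 < k" and e_def: "e = gcd k N"
  shows "card {M. size M = m \<and> image_mset ((*) (g ^ k)) M = M}
         = ((CARD('a) + m - 1) div (N div e)) choose (m div (N div e))"
proof -
  have Npos: "N > 0"
    using card_mono[of UNIV "{0::'a, 1}"] by (simp add: N_def)
  have epos: "e > 0" using k by (simp add: e_def)
  define d where "d = N div e"
  have Ned: "N = e * d" by (simp add: d_def e_def)
  have dpos: "d > 0" using Npos Ned by auto
  have g0: "g \<noteq> 0" using one Npos by (auto simp: power_0_left)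
  have gpow: "g ^ i = g ^ (i mod N)" for i
  proof -
    have "g ^ i = g ^ (N * (i div N) + i mod N)" by simp
    also have "\<dots> = g ^ (i mod N)" by (simp only: power_add power_mult one) simp
    finally show ?thesis .
  qed
  have size_eq: "size M = count M 0 + (\<Sum>i<N. count M (g ^ i))" for M :: "'a multiset"
  proof -
    have "size M = (\<Sum>x\<in>UNIV. count M x)"
      unfolding size_multiset_overloaded_eq
      by (rule sum.mono_neutral_left) (auto simp: not_in_iff)
    also have "\<dots> = count M 0 + (\<Sum>x\<in>UNIV - {0}. count M x)"
      by (simp add: sum.remove)
    also have "(\<Sum>x\<in>UNIV - {0}. count M x) = (\<Sum>i<N. count M (g ^ i))"
      using sum.reindex_bij_betw[OF bij, of "count M"] by simp
    finally show ?thesis .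
  qed
  have inv_iff: "image_mset ((*) (g ^ k)) M = M \<longleftrightarrow> (\<forall>x. count M (g ^ k * x) = count M x)"
    for M :: "'a multiset"
  proof -
    have inj: "inj ((*) (g ^ k))" using g0 by (auto simp: inj_def)
    have cnt: "count (image_mset ((*) (g ^ k)) M) (g ^ k * x) = count M x" for x
      using inj by (induction M) (auto simp: inj_eq)
    have sur: "\<exists>x. y = g ^ k * x" for y using g0 by (intro exI[of _ "y / g ^ k"]) simp
    show ?thesis
    proof
      assume "image_mset ((*) (g ^ k)) M = M"
      thus "\<forall>x. count M (g ^ k * x) = count M x" using cnt by metis
    next
      assume *: "\<forall>x. count M (g ^ k * x) = count M x"
      show "image_mset ((*) (g ^ k)) M = M"
      proof (rule multiset_eqI)
        fix y obtain x where "y = g ^ k * x" using sur by blast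
        thus "count (image_mset ((*) (g ^ k)) M) y = count M y" using * cnt by simp
      qed
    qed
  qed
  \<comment> \<open>The discrete logarithm to base \<open>g\<close>, with values below
    \<open>N\<close>.\<close>
  define lg where "lg = inv_into {..<N} (\<lambda>i. g ^ i)"
  have lg: "lg x < N" "g ^ lg x = x" if "x \<noteq> 0" for x
  proof -
    have "x \<in> (\<lambda>i. g ^ i) ` {..<N}" using bij that unfolding bij_betw_def by auto
    thus "lg x < N" "g ^ lg x = x"
      unfolding lg_def using inv_into_into[of x "\<lambda>i. g ^ i" "{..<N}"] f_inv_into_f[of x "\<lambda>i. g ^ i" "{..<N}"] by auto
  qed
  have lg_pow: "lg (g ^ i) = i mod N" for i
  proof -
    have "lg (g ^ (i mod N)) = i mod N"
      unfolding lg_def using bij Npos by (intro inv_into_f_f) (auto simp: bij_betw_def)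
    thus ?thesis using gpow[of i] by simp
  qed
  let ?S = "{M :: 'a multiset. size M = m \<and> image_mset ((*) (g ^ k)) M = M}"
  let ?L = "{l :: nat list. length l = e \<and> sum_list l \<le> m div d}"
  let ?to = "\<lambda>M :: 'a multiset. map (\<lambda>i. count M (g ^ i)) [0..<e]"
  \<comment> \<open>A nonzero \<open>x\<close> gets the entry of its coset, and \<open>0\<close>
    gets what is left of \<open>m\<close>. The truncated subtraction is exact on
    \<open>?L\<close>.\<close>
  let ?cnt = "\<lambda>l x. if x = 0 then m - d * sum_list l else l ! (lg x mod e)"
  let ?from = "\<lambda>l. Abs_multiset (?cnt l)"
  have cnt_from: "count (?from l) = ?cnt l" for l
    by (subst Abs_multiset_inverse) auto
  have sl: "sum_list (map f [0..<e]) = (\<Sum>i<e. f i)" for f :: "nat \<Rightarrow> nat"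
    by (simp add: interv_sum_list_conv_sum_set_nat atLeast0LessThan)
  have S_props: "count M (g ^ i) = count M (g ^ (i mod e))"
    "size M = count M 0 + d * (\<Sum>i<e. count M (g ^ i))" if "M \<in> ?S" for M i
  proof -
    have inv: "count M (g ^ k * x) = count M x" for x using that inv_iff by auto
    \<comment> \<open>Along the powers of \<open>g\<close> the counts have period \<open>k\<close>
      by invariance and period \<open>N\<close> by \<open>one\<close>, hence period
      \<open>e\<close>.\<close>
    have *: "count M (g ^ (i mod e)) = count M (g ^ i)" for i
      unfolding e_def using k inv[of "g ^ i" for i]
      by (intro periodic_gcd[where h = "\<lambda>i. count M (g ^ i)"]) (auto simp: power_add one mult.commute)
    show "count M (g ^ i) = count M (g ^ (i mod e))" using *[of i] by simp
    have "(\<Sum>i<N. count M (g ^ i)) = (\<Sum>i<e * d. count M (g ^ (i mod e)))"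
      unfolding Ned by (intro sum.cong refl) (simp add: *)
    thus "size M = count M 0 + d * (\<Sum>i<e. count M (g ^ i))"
      unfolding size_eq[of M] sum_periodic[of "\<lambda>i. count M (g ^ i)"] by simp
  qed
  have "bij_betw ?to ?S ?L"
  proof (rule bij_betw_byWitness[where f' = ?from])
    show "\<forall>M\<in>?S. ?from (?to M) = M"
    proof
      fix M assume M: "M \<in> ?S"
      show "?from (?to M) = M"
      proof (rule multiset_eqI)
        fix x
        show "count (?from (?to M)) x = count M x"
        proof (cases "x = 0")
          case True
          have "size M = m" using M by simp
          thus ?thesis using S_props(2)[OF M] True by (simp add: cnt_from sl)
        next
          case False
          have "count M (g ^ (lg x mod e)) = count M x"
            using S_props(1)[OF M, of "lg x"] lg[OF False] by simp
          thus ?thesis using False epos by (simp add: cnt_from)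
        qed
      qed
    qed
    show "\<forall>l\<in>?L. ?to (?from l) = l"
    proof
      fix l :: "nat list" assume l: "l \<in> ?L"
      show "?to (?from l) = l"
      proof (rule nth_equalityI)
        fix i assume "i < length (?to (?from l))"
        hence i: "i < e" by simp
        have "i mod N = i" using i Ned dpos by (simp add: less_le_trans[of i e])
        thus "?to (?from l) ! i = l ! i" using i g0 by (simp add: cnt_from lg_pow)
      qed (use l in simp)
    qed
    show "?to ` ?S \<subseteq> ?L"
    proof (rule image_subsetI)
      fix M assume M: "M \<in> ?S"
      have "d * (\<Sum>i<e. count M (g ^ i)) \<le> m" using S_props(2)[OF M] M by simp
      hence "sum_list (?to M) \<le> m div d"
        unfolding sl using dpos by (simp add: less_eq_div_iff_mult_less_eq mult.commute)
      thus "?to M \<in> ?L" by simp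
    qed
    show "?from ` ?L \<subseteq> ?S"
    proof (intro image_subsetI CollectI conjI)
      fix l :: "nat list" assume "l \<in> ?L"
      hence l: "length l = e" "sum_list l \<le> m div d" by auto
      show "size (?from l) = m"
      proof -
        have "(\<Sum>i<N. count (?from l) (g ^ i)) = (\<Sum>i<e * d. l ! (i mod e))"
          unfolding Ned[symmetric] using g0 by (intro sum.cong refl) (simp add: cnt_from lg_pow)
        also have "\<dots> = d * sum_list l"
          by (simp add: sum_periodic sum_list_sum_nth l atLeast0LessThan)
        finally have "size (?from l) = (m - d * sum_list l) + d * sum_list l"
          unfolding size_eq by (simp add: cnt_from)
        moreover have "d * sum_list l \<le> m"
          using l(2) dpos by (simp add: less_eq_div_iff_mult_less_eq mult.commute)
        ultimately show ?thesis by simp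
      qed
      show "image_mset ((*) (g ^ k)) (?from l) = ?from l"
        unfolding inv_iff
      proof
        fix x
        show "count (?from l) (g ^ k * x) = count (?from l) x"
        proof (cases "x = 0")
          case False
          have "g ^ k * x = g ^ (k + lg x)" using lg[OF False] by (simp add: power_add)
          hence "lg (g ^ k * x) = (k + lg x) mod N" by (simp add: lg_pow)
          \<comment> \<open>Modulo \<open>e\<close> neither the reduction modulo \<open>N\<close>
            nor the shift by \<open>k\<close> is visible, since \<open>e\<close> divides
            both.\<close>
          hence "lg (g ^ k * x) mod e = (k + lg x) mod e"
            by (simp add: mod_mod_cancel e_def)
          also have "e dvd k" by (simp add: e_def)
          hence "(k + lg x) mod e = lg x mod e" by (auto simp: dvd_def)
          finally show ?thesis using False g0 by (simp add: cnt_from)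
        qed simp
      qed
    qed
  qed
  hence "card ?S = card ?L" by (rule bij_betw_same_card)
  also have "\<dots> = (m div d + e) choose (m div d)" by (rule card_lists_sum_list_le)
  \<comment> \<open>Since \<open>N = e * d\<close>, adding \<open>e\<close> to the quotient adds
    \<open>N\<close> to the dividend.\<close>
  also have "m div d + e = (e * d + m) div d" using dpos by simp
  also have "e * d + m = CARD('a) + m - 1" unfolding Ned[symmetric] by (simp add: N_def)
  finally show ?thesis by (simp add: d_def)
qed

lemma sum_card_invariant_multisets:
  "(\<Sum>c\<in>UNIV - {0 :: 'a::{field, finite}}. card {M. size M = m \<and> image_mset ((*) c) M = M})
   = (\<Sum>d | d dvd CARD('a) - 1. totient d * ((CARD('a) + m - 1) div d choose (m div d)))"
proof -
  define N where "N = CARD('a) - 1"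
  have Npos: "N > 0"
    using card_mono[of UNIV "{0::'a, 1}"] by (simp add: N_def)
  obtain g :: 'a where bij: "bij_betw (\<lambda>i. g ^ i) {..<N} (UNIV - {0})" and one: "g ^ N = 1"
    using finite_field_generator unfolding N_def by blast
  define F where "F c = card {M. size M = m \<and> image_mset ((*) c) M = M}" for c :: 'a
  define B where "B d = ((CARD('a) + m - 1) div d choose (m div d))" for d
  have "(\<Sum>c\<in>UNIV - {0}. F c) = (\<Sum>i<N. F (g ^ i))"
    using sum.reindex_bij_betw[OF bij, of F] by simp
  \<comment> \<open>The scalar 1 is written as \<open>g ^ N\<close> instead of \<open>g ^ 0\<close>,
    so that all exponents are positive, as the multiset count and the totient count require.\<close>
  also have "\<dots> = (\<Sum>k\<in>{0<..N}. F (g ^ k))"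
  proof -
    have "{0<..N} = insert N {0<..<N}" "{..<N} = insert 0 {0<..<N}" using Npos by auto
    thus ?thesis by (simp add: one)
  qed
  also have "\<dots> = (\<Sum>k\<in>{0<..N}. B (N div gcd k N))"
    unfolding F_def B_def N_def
    by (intro sum.cong refl card_invariant_multisets bij[unfolded N_def] one[unfolded N_def]) auto
  \<comment> \<open>The exponents with \<open>gcd k N = e\<close> are those of the scalars of order
    \<open>N div e\<close>, and there are \<open>totient (N div e)\<close> of them. Passing to the
    complementary divisor afterwards makes the order the summation index.\<close>
  also have "\<dots> = (\<Sum>e | e dvd N. \<Sum>k | k \<in> {0<..N} \<and> gcd k N = e. B (N div gcd k N))"
    using Npos by (intro sum.group[symmetric]) auto
  also have "\<dots> = (\<Sum>e | e dvd N. totient (N div e) * B (N div e))"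
    using Npos by (intro sum.cong refl) (simp add: card_gcd_eq_totient[symmetric] conj_commute)
  also have "\<dots> = (\<Sum>d | d dvd N. totient d * B d)"
    using Npos
    by (intro sum.reindex_bij_witness[of _ "\<lambda>d. N div d" "\<lambda>d. N div d"]) (auto elim!: dvdE)
  finally show ?thesis unfolding F_def B_def N_def .
qed

subsection \<open>Permutations acting on lists\<close>

text \<open>Orbit-stabiliser for permutations of positions: the orbit of \<open>xs\<close> consists
  of all its rearrangements, and the permutations leading to any given one are as many as those
  fixing \<open>xs\<close>.\<close>

lemma card_permuting_list:
  assumes "mset ys = mset xs"
  shows "card {\<rho>. \<rho> permutes {..<length xs} \<and> permute_list \<rho> xs = ys} * card {zs. mset zs = mset xs}
         = fact (length xs)"
proof -
  let ?n = "length xs"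
  define P where "P zs = {\<rho>. \<rho> permutes {..<?n} \<and> permute_list \<rho> xs = zs}" for zs
  have fin: "finite {\<rho>. \<rho> permutes {..<?n}}" by (simp add: finite_permutations)
  have card_P: "card (P zs) = card (P xs)" if zs: "mset zs = mset xs" for zs
  proof -
    obtain p where p: "p permutes {..<?n}" "permute_list p xs = zs"
      by (rule mset_eq_permutation[OF zs])
    \<comment> \<open>\<open>permute_list (\<rho> \<circ> p) xs\<close> permutes by
      \<open>\<rho>\<close> first and then by \<open>p\<close>, so right composition with
      \<open>p\<close> moves the stabiliser of \<open>xs\<close> onto the fibre over
      \<open>zs\<close>.\<close>
    have "bij_betw (\<lambda>\<rho>. \<rho> \<circ> p) (P xs) (P zs)"
    proof (rule bij_betw_byWitness[where f' = "\<lambda>\<rho>. \<rho> \<circ> inv_into UNIV p"])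
      show "\<forall>\<rho>\<in>P xs. (\<rho> \<circ> p) \<circ> inv_into UNIV p = \<rho>" "\<forall>\<rho>\<in>P zs. (\<rho> \<circ> inv_into UNIV p) \<circ> p = \<rho>"
        using permutes_inv_o[OF p(1)] by (auto simp: comp_assoc)
      show "(\<lambda>\<rho>. \<rho> \<circ> p) ` P xs \<subseteq> P zs"
        using p by (auto simp: P_def permute_list_compose permutes_compose)
      have "permute_list (inv_into UNIV p) zs = permute_list (p \<circ> inv_into UNIV p) xs"
        using permute_list_compose[OF permutes_inv[OF p(1)], of p] p(2) by simp
      hence "permute_list (inv_into UNIV p) zs = xs" using permutes_inv_o[OF p(1)] by simp
      thus "(\<lambda>\<rho>. \<rho> \<circ> inv_into UNIV p) ` P zs \<subseteq> P xs"
        using permutes_inv[OF p(1)] by (auto simp: P_def permute_list_compose permutes_compose)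
    qed
    thus ?thesis by (simp add: bij_betw_same_card)
  qed
  have finZ: "finite {zs. mset zs = mset xs}"
    using finite_permutations_of_multiset[of "mset xs"] by (simp add: permutations_of_multiset_def)
  have "fact ?n = card {\<rho>. \<rho> permutes {..<?n}}" by (simp add: card_permutations[of _ ?n])
  also have "{\<rho>. \<rho> permutes {..<?n}} = (\<Union>zs\<in>{zs. mset zs = mset xs}. P zs)"
    by (auto simp: P_def)
  also have "card \<dots> = (\<Sum>zs\<in>{zs. mset zs = mset xs}. card (P zs))"
    using finZ finite_subset[OF _ fin] by (intro card_UN_disjoint) (auto simp: P_def)
  also have "\<dots> = (\<Sum>zs\<in>{zs. mset zs = mset xs}. card (P ys))"
    by (intro sum.cong refl) (metis assms card_P mem_Collect_eq)
  finally show ?thesis by (simp add: P_def mult.commute)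
qed

text \<open>Lists are grouped by their multiset \<open>M\<close> of entries. If \<open>f\<close>
  preserves \<open>M\<close>, then \<open>map f xs\<close> is a rearrangement of \<open>xs\<close>,
  and each list in the group contributes \<open>fact m\<close> divided by the size of the group, in
  total \<open>fact m\<close>. Otherwise nothing is contributed, since permuting keeps the
  multiset.\<close>

lemma card_permutation_eigenlists:
  fixes f :: "'a::finite \<Rightarrow> 'a"
  shows "(\<Sum>xs | length xs = m. card {\<rho>. \<rho> permutes {..<m} \<and> permute_list \<rho> xs = map f xs})
         = fact m * card {M. size M = m \<and> image_mset f M = M}"
proof -
  define g where "g xs = card {\<rho>. \<rho> permutes {..<m} \<and> permute_list \<rho> xs = map f xs}" for xs
  define I where "I = {M. size M = m \<and> image_mset f M = M}"
  have finL: "finite {xs :: 'a list. length xs = m}"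
    using finite_lists_length_eq[of "UNIV :: 'a set" m] by simp
  have img: "mset ` {xs :: 'a list. length xs = m} = {M. size M = m}"
    by (auto simp: image_iff) (metis ex_mset size_mset)
  have finM: "finite {M :: 'a multiset. size M = m}"
    using finL by (simp flip: img)
  have cls: "(\<Sum>xs | length xs = m \<and> mset xs = M. g xs) = (if M \<in> I then fact m else 0)"
    if "size M = m" for M
  proof (cases "M \<in> I")
    case True
    have eq: "{xs. length xs = m \<and> mset xs = M} = {xs. mset xs = M}" using that by auto
    have "real (g xs) = fact m / card {xs. mset xs = M}" if "mset xs = M" for xs
    proof -
      have "length xs = m" "mset (map f xs) = mset xs" using that True by (auto simp: I_def)
      from card_permuting_list[OF this(2)] this(1)
      have "g xs * card {zs. mset zs = M} = fact m" using that by (simp add: g_def)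
      hence "real (g xs) * card {zs. mset zs = M} = fact m" by (metis of_nat_fact of_nat_mult)
      moreover have "card {zs. mset zs = M} \<noteq> 0" using calculation by (intro notI) auto
      ultimately show ?thesis by (simp add: field_simps)
    qed
    hence "real (\<Sum>xs | mset xs = M. g xs) = card {xs. mset xs = M} * (fact m / card {xs. mset xs = M})"
      by simp
    also have "card {xs. mset xs = M} \<noteq> 0"
      using finite_permutations_of_multiset[of M] ex_mset[of M] by (auto simp: permutations_of_multiset_def card_eq_0_iff)
    hence "card {xs. mset xs = M} * (fact m / card {xs. mset xs = M}) = (fact m :: real)" by simp
    finally have "(\<Sum>xs | mset xs = M. g xs) = fact m" by (metis of_nat_fact of_nat_eq_iff)
    thus ?thesis using True by (simp add: eq)
  next
    case False
    have "g xs = 0" if "length xs = m" "mset xs = M" for xs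
    proof -
      have "permute_list \<rho> xs \<noteq> map f xs" if "\<rho> permutes {..<m}" for \<rho>
        using False mset_permute_list[of \<rho> xs] that \<open>length xs = m\<close> \<open>mset xs = M\<close> \<open>size M = m\<close>
        by (metis (mono_tags, lifting) I_def mem_Collect_eq mset_map)
      hence "{\<rho>. \<rho> permutes {..<m} \<and> permute_list \<rho> xs = map f xs} = {}" by blast
      thus ?thesis unfolding g_def by (simp only: card.empty)
    qed
    thus ?thesis using False by simp
  qed
  have "(\<Sum>xs | length xs = m. g xs) = (\<Sum>M | size M = m. \<Sum>xs | xs \<in> {xs. length xs = m} \<and> mset xs = M. g xs)"
    using finL finM img by (intro sum.group[symmetric]) auto
  also have "\<dots> = (\<Sum>M | size M = m. if M \<in> I then fact m else 0)"
    by (intro sum.cong refl) (simp add: cls)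
  also have "\<dots> = fact m * card I"
  proof -
    have "{M. size M = m} \<inter> I = I" by (auto simp: I_def)
    thus ?thesis using finM by (simp add: sum.inter_restrict[symmetric])
  qed
  finally show ?thesis by (simp add: g_def I_def)
qed

subsection \<open>Full-rank matrices annihilating given vectors\<close>

text \<open>With \<open>l\<close> rows, rank \<open>l\<close> means that the columns span the whole
  space. Surjectivity is the convenient form: it passes to products and yields fibres of equal
  size.\<close>

lemma full_rank_mats_iff:
  "A \<in> rank_mats l m l \<longleftrightarrow>
     A \<in> carrier_mat l m \<and> (\<forall>y\<in>carrier_vec l. \<exists>x\<in>carrier_vec m. A *\<^sub>v x = y)"
  for A :: "'a::field mat"
proof -
  interpret vec_space "TYPE('a)" l .
  have "rank A = l \<longleftrightarrow> (\<forall>y\<in>carrier_vec l. \<exists>x\<in>carrier_vec m. A *\<^sub>v x = y)"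
    if A: "A \<in> carrier_mat l m"
  proof -
    have cs: "span (set (cols A)) = {y\<in>carrier_vec l. \<exists>x\<in>carrier_vec m. A *\<^sub>v x = y}"
      using col_space_eq[OF A] A by (simp add: col_space_def)
    have sub: "set (cols A) \<subseteq> carrier_vec l" using A cols_dim by blast
    show ?thesis
    proof
      assume r: "rank A = l"
      \<comment> \<open>A maximal independent set of columns has \<open>rank A = l\<close> elements,
        hence is a basis of the \<open>l\<close>-dimensional space.\<close>
      obtain S where S: "finite S" "maximal S (\<lambda>T. T \<subseteq> set (cols A) \<and> lin_indpt T)"
        using maximal_exists_superset[of "set (cols A)" "\<lambda>T. T \<subseteq> set (cols A) \<and> lin_indpt T" "{}"]
        by (auto simp: lin_dep_def)
      have li: "S \<subseteq> set (cols A)" "lin_indpt S" using S(2) by (auto simp: maximal_def)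
      have "card S = l" using rank_card_indpt[OF A S(2)] r by simp
      hence "basis S"
        using li sub S(1) dim_is_n by (intro dim_li_is_basis) auto
      hence "span S = carrier_vec l" by (simp add: basis_def)
      moreover have "span S \<subseteq> span (set (cols A))" using li(1) by (rule span_is_monotone)
      ultimately show "\<forall>y\<in>carrier_vec l. \<exists>x\<in>carrier_vec m. A *\<^sub>v x = y"
        unfolding cs by auto
    next
      assume "\<forall>y\<in>carrier_vec l. \<exists>x\<in>carrier_vec m. A *\<^sub>v x = y"
      hence sp: "span (set (cols A)) = carrier_vec l" unfolding cs by auto
      \<comment> \<open>\<open>rank\<close> is the dimension of the column span taken as a space of
        its own; here that space is all of \<open>V\<close>.\<close>
      have V: "V\<lparr>carrier := carrier_vec l\<rparr> = V" unfolding module_vec_def by simp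
      show "rank A = l" unfolding rank_def sp V by (rule dim_is_n)
    qed
  qed
  thus ?thesis unfolding rank_mats_def by blast
qed

text \<open>One nonzero vector is linearly independent, and the zero matrix has rank 0. Hence
  \<open>B\<close> is sampled from exactly the nonzero columns.\<close>

lemma rank_one_column_iff:
  "B \<in> rank_mats m 1 1 \<longleftrightarrow> B \<in> carrier_mat m 1 \<and> B \<noteq> 0\<^sub>m m 1" for B :: "'a::field mat"
proof -
  interpret vec_space "TYPE('a)" m .
  have "rank B = 1" if B: "B \<in> carrier_mat m 1" "B \<noteq> 0\<^sub>m m 1"
  proof (rule lin_indpt_full_rank[OF B(1)])
    have cols: "cols B = [col B 0]" using B(1) by (auto simp: cols_def)
    show dist: "distinct (cols B)" by (simp add: cols)
    show "lin_indpt (set (cols B))"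
    proof
      assume "lin_dep (set (cols B))"
      from lin_depE[OF B(1) this dist] obtain v where
        v: "v \<in> carrier_vec 1" "v \<noteq> 0\<^sub>v 1" "B *\<^sub>v v = 0\<^sub>v m" by blast
      have v0: "v $ 0 \<noteq> 0" using v(1,2) by (auto simp: vec_eq_iff)
      have "B $$ (i, 0) = 0" if "i < m" for i
      proof -
        have "(B *\<^sub>v v) $ i = 0" using v(3) that by simp
        moreover have "(B *\<^sub>v v) $ i = B $$ (i, 0) * v $ 0"
          using B(1) v(1) that by (simp add: scalar_prod_def)
        ultimately show ?thesis using v0 by simp
      qed
      hence "B = 0\<^sub>m m 1" using B(1) by (intro eq_matI) auto
      thus False using B(2) by simp
    qed
  qed
  moreover have "rank B \<noteq> 1" if "B = 0\<^sub>m m 1" using rank_0I[of 1] that by simp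
  ultimately show ?thesis unfolding rank_mats_def by blast
qed

section \<open>Cardinalities of vector spaces and kernels\<close>

lemma bij_betw_vec_of_list: "bij_betw vec_of_list {xs. length xs = m} (carrier_vec m)"
proof (rule bij_betwI[where g = list_of_vec])
  show "vec_of_list \<in> {xs. length xs = m} \<rightarrow> carrier_vec m"
    by (intro funcsetI carrier_vecI) simp
  show "list_of_vec \<in> carrier_vec m \<rightarrow> {xs. length xs = m}"
    by (intro funcsetI CollectI) (simp only: length_list_of_vec carrier_vecD)
qed (rule list_vec, rule vec_list)

lemma finite_carrier_vec: "finite (carrier_vec m :: 'a::finite vec set)"
  and card_carrier_vec: "card (carrier_vec m :: 'a::finite vec set) = CARD('a) ^ m"
proof -
  show "finite (carrier_vec m :: 'a vec set)"
    using bij_betw_finite[OF bij_betw_vec_of_list[of m, where 'a = 'a]]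
      finite_lists_length_eq[of "UNIV :: 'a set" m] by simp
  show "card (carrier_vec m :: 'a vec set) = CARD('a) ^ m"
    using bij_betw_same_card[OF bij_betw_vec_of_list[of m, where 'a = 'a]]
      card_lists_length_eq[of "UNIV :: 'a set" m] by simp
qed

lemma finite_carrier_mat: "finite (carrier_mat l m :: 'a::finite mat set)"
proof -
  have "mat_of_rows m ` {xs. set xs \<subseteq> carrier_vec m \<and> length xs = l} \<supseteq> (carrier_mat l m :: 'a mat set)"
  proof
    fix A :: "'a mat" assume A: "A \<in> carrier_mat l m"
    hence "A = mat_of_rows m (Matrix.rows A)" by (metis carrier_matD(2) mat_of_rows_rows)
    moreover have "Matrix.rows A \<in> {xs. set xs \<subseteq> carrier_vec m \<and> length xs = l}"
      using A by (auto simp: Matrix.rows_def)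
    ultimately show "A \<in> mat_of_rows m ` {xs. set xs \<subseteq> carrier_vec m \<and> length xs = l}" by blast
  qed
  thus ?thesis using finite_lists_length_eq[OF finite_carrier_vec, of m l] finite_surj by blast
qed

text \<open>Every fibre of the surjection \<open>A\<close> is a translate of the kernel, so
  \<open>CARD('a) ^ l\<close> fibres of equal size partition the space.\<close>

lemma card_kernel_full_rank:
  fixes A :: "'a::{field, finite} mat"
  assumes "A \<in> rank_mats l m l" and "l \<le> m"
  shows "card {x \<in> carrier_vec m. A *\<^sub>v x = 0\<^sub>v l} = CARD('a) ^ (m - l)"
proof -
  have A: "A \<in> carrier_mat l m" and sur: "\<And>y. y \<in> carrier_vec l \<Longrightarrow> \<exists>x\<in>carrier_vec m. A *\<^sub>v x = y"
    using assms(1) by (auto simp: full_rank_mats_iff)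
  let ?K = "{x \<in> carrier_vec m. A *\<^sub>v x = 0\<^sub>v l}"
  have fib: "card {x \<in> carrier_vec m. A *\<^sub>v x = y} = card ?K" if y: "y \<in> carrier_vec l" for y
  proof -
    obtain x0 where x0: "x0 \<in> carrier_vec m" "A *\<^sub>v x0 = y" using sur[OF y] by blast
    have "bij_betw (\<lambda>x. x - x0) {x \<in> carrier_vec m. A *\<^sub>v x = y} ?K"
      using x0 y A
      by (intro bij_betw_byWitness[where f' = "\<lambda>x. x + x0"])
         (auto simp: mult_add_distrib_mat_vec[OF A] mult_minus_distrib_mat_vec[OF A])
    thus ?thesis by (rule bij_betw_same_card)
  qed
  have "CARD('a) ^ m = card (\<Union>y\<in>carrier_vec l. {x \<in> carrier_vec m. A *\<^sub>v x = y})"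
    unfolding card_carrier_vec[symmetric] by (rule arg_cong[of _ _ card]) (use A in auto)
  also have "\<dots> = (\<Sum>y\<in>carrier_vec l. card {x \<in> carrier_vec m. A *\<^sub>v x = y})"
    by (intro card_UN_disjoint ballI finite_carrier_vec finite_subset[OF _ finite_carrier_vec]) auto
  also have "\<dots> = (\<Sum>y\<in>(carrier_vec l :: 'a vec set). card ?K)" by (intro sum.cong refl fib)
  also have "\<dots> = CARD('a) ^ l * card ?K" by (simp add: card_carrier_vec)
  also have "CARD('a) ^ m = CARD('a) ^ l * CARD('a) ^ (m - l)"
    using assms(2) by (simp flip: power_add)
  finally show ?thesis by simp
qed

section \<open>Transitivity on the vectors off a line\<close>

lemma separating_functional:
  fixes u v :: "'a::field vec"
  assumes u: "u \<in> carrier_vec m" "u \<noteq> 0\<^sub>v m" and v: "v \<in> carrier_vec m" "\<And>c. v \<noteq> c \<cdot>\<^sub>v u"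
  obtains f where "f \<in> carrier_vec m" "f \<bullet> u = 0" "f \<bullet> v \<noteq> 0"
proof -
  obtain i where i: "i < m" "u $ i \<noteq> 0" using u by (auto simp: vec_eq_iff)
  \<comment> \<open>A coordinate where \<open>v\<close> differs from the multiple of
    \<open>u\<close> that agrees with \<open>v\<close> at \<open>i\<close>.\<close>
  obtain j where j: "j < m" "v $ j \<noteq> (v $ i / u $ i) * u $ j"
    using v(2)[of "v $ i / u $ i"] u(1) v(1) by (auto simp: vec_eq_iff)
  \<comment> \<open>As a functional of \<open>x\<close>, this is the 2 by 2 minor of
    \<open>u\<close> and \<open>x\<close> in rows \<open>i\<close> and \<open>j\<close>: it vanishes
    on \<open>u\<close> but not on \<open>v\<close>.\<close>
  define f where "f = u $ i \<cdot>\<^sub>v unit_vec m j - u $ j \<cdot>\<^sub>v unit_vec m i"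
  have fx: "f \<bullet> x = u $ i * x $ j - u $ j * x $ i" if "x \<in> carrier_vec m" for x
    using that i(1) j(1) unfolding f_def
    by (subst minus_scalar_prod_distrib[of _ m]) auto
  show thesis
    by (rule that[of f]) (use i j u v in \<open>auto simp: fx field_simps\<close>, simp add: f_def)
qed

text \<open>A functional nonzero on \<open>v\<close> and one nonzero on \<open>w\<close> yield one
  nonzero on both: one of the two works already, or their sum does. Scaling then gives the value 1
  on \<open>v\<close>.\<close>

lemma common_separating_functional:
  fixes u v w :: "'a::field vec"
  assumes u: "u \<in> carrier_vec m" "u \<noteq> 0\<^sub>v m"
    and v: "v \<in> carrier_vec m" "\<And>c. v \<noteq> c \<cdot>\<^sub>v u"
    and w: "w \<in> carrier_vec m" "\<And>c. w \<noteq> c \<cdot>\<^sub>v u"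
  obtains f where "f \<in> carrier_vec m" "f \<bullet> u = 0" "f \<bullet> v = 1" "f \<bullet> w \<noteq> 0"
proof -
  obtain f where f: "f \<in> carrier_vec m" "f \<bullet> u = 0" "f \<bullet> v \<noteq> 0"
    using separating_functional[OF u v] by blast
  obtain g where g: "g \<in> carrier_vec m" "g \<bullet> u = 0" "g \<bullet> w \<noteq> 0"
    using separating_functional[OF u w] by blast
  have add: "(f + g) \<bullet> x = f \<bullet> x + g \<bullet> x" if "x \<in> carrier_vec m" for x
    using f(1) g(1) that by (rule add_scalar_prod_distrib)
  obtain h where h: "h \<in> carrier_vec m" "h \<bullet> u = 0" "h \<bullet> v \<noteq> 0" "h \<bullet> w \<noteq> 0"
  proof (cases "f \<bullet> w = 0 \<and> g \<bullet> v = 0")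
    case True
    thus thesis using f g u v w by (intro that[of "f + g"]) (auto simp: add)
  next
    case False
    thus thesis using f g that by blast
  qed
  show thesis
    by (rule that[of "inverse (h \<bullet> v) \<cdot>\<^sub>v h"]) (use h u v w in auto)
qed

text \<open>The linear map taking \<open>x\<close> to \<open>x + f(x) (w - v)\<close>, where
  \<open>f(u) = 0\<close> and \<open>f(v) = 1\<close>, fixes \<open>u\<close> and sends
  \<open>v\<close> to \<open>w\<close>. It is onto because \<open>1 + f(w - v) = f(w)\<close> is
  nonzero.\<close>

lemma shear_exists:
  fixes u v w :: "'a::field vec"
  assumes u: "u \<in> carrier_vec m" "u \<noteq> 0\<^sub>v m"
    and v: "v \<in> carrier_vec m" "\<And>c. v \<noteq> c \<cdot>\<^sub>v u"
    and w: "w \<in> carrier_vec m" "\<And>c. w \<noteq> c \<cdot>\<^sub>v u"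
  obtains P where "P \<in> carrier_mat m m" "P *\<^sub>v u = u" "P *\<^sub>v v = w"
    "\<And>y. y \<in> carrier_vec m \<Longrightarrow> \<exists>x\<in>carrier_vec m. P *\<^sub>v x = y"
proof -
  obtain f where f: "f \<in> carrier_vec m" "f \<bullet> u = 0" "f \<bullet> v = 1" "f \<bullet> w \<noteq> 0"
    using common_separating_functional[OF u v w] by blast
  define P where "P = Matrix.mat m m (\<lambda>(i, j). (if i = j then 1 else 0) + (w $ i - v $ i) * f $ j)"
  have P: "P \<in> carrier_mat m m" by (simp add: P_def)
  have Px: "P *\<^sub>v x = x + (f \<bullet> x) \<cdot>\<^sub>v (w - v)" if x: "x \<in> carrier_vec m" for x
  proof (rule eq_vecI)
    fix i assume "i < dim_vec (x + (f \<bullet> x) \<cdot>\<^sub>v (w - v))"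
    hence i: "i < m" using v w by simp
    have "(P *\<^sub>v x) $ i = (\<Sum>j<m. ((if i = j then 1 else 0) + (w $ i - v $ i) * f $ j) * x $ j)"
      using i x P by (simp add: P_def scalar_prod_def atLeast0LessThan)
    also have "\<dots> = (\<Sum>j<m. (if i = j then x $ j else 0)) + (w $ i - v $ i) * (\<Sum>j<m. f $ j * x $ j)"
      unfolding sum_distrib_left sum.distrib[symmetric]
      by (intro sum.cong refl) (auto simp: algebra_simps)
    also have "\<dots> = (x + (f \<bullet> x) \<cdot>\<^sub>v (w - v)) $ i"
      using i x v w by (simp add: scalar_prod_def atLeast0LessThan mult.commute)
    finally show "(P *\<^sub>v x) $ i = (x + (f \<bullet> x) \<cdot>\<^sub>v (w - v)) $ i" .
  qed (use P v w x in auto)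
  show thesis
  proof (rule that[OF P])
    show "P *\<^sub>v u = u" "P *\<^sub>v v = w"
      using Px[of u] Px[of v] u v w f by (auto intro!: eq_vecI)
    fix y :: "'a Matrix.vec" assume y: "y \<in> carrier_vec m"
    \<comment> \<open>Applying \<open>f\<close> to \<open>x + f(x) (w - v) = y\<close> forces
      \<open>f(x) = f(y) / f(w)\<close>, which determines \<open>x\<close>.\<close>
    define x where "x = y - ((f \<bullet> y) / (f \<bullet> w)) \<cdot>\<^sub>v (w - v)"
    have x: "x \<in> carrier_vec m" using y v w by (simp add: x_def)
    have "f \<bullet> x = f \<bullet> y - ((f \<bullet> y) / (f \<bullet> w)) * (f \<bullet> w - 1)"
      using f y v w by (simp add: x_def scalar_prod_minus_distrib[of _ m])
    also have "\<dots> = (f \<bullet> y) / (f \<bullet> w)" using f(4) by (simp add: field_simps)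
    finally have "P *\<^sub>v x = y"
      using Px[OF x] y v w by (auto simp: x_def intro!: eq_vecI)
    thus "\<exists>x\<in>carrier_vec m. P *\<^sub>v x = y" using x by blast
  qed
qed

text \<open>Right multiplication by a matrix that fixes \<open>u\<close> and sends \<open>v\<close>
  to \<open>w\<close> embeds one set into the other; its surjectivity gives both injectivity of the
  embedding and preservation of full rank. Exchanging \<open>v\<close> and \<open>w\<close> later
  turns the bound into an equality.\<close>

lemma card_annihilators_le:
  fixes u v w :: "'a::{field, finite} vec"
  assumes u: "u \<in> carrier_vec m" "u \<noteq> 0\<^sub>v m"
    and v: "v \<in> carrier_vec m" "\<And>c. v \<noteq> c \<cdot>\<^sub>v u"
    and w: "w \<in> carrier_vec m" "\<And>c. w \<noteq> c \<cdot>\<^sub>v u"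
  shows "card {A \<in> rank_mats l m l. A *\<^sub>v u = 0\<^sub>v l \<and> A *\<^sub>v w = 0\<^sub>v l}
         \<le> card {A \<in> rank_mats l m l. A *\<^sub>v u = 0\<^sub>v l \<and> A *\<^sub>v v = 0\<^sub>v l}" (is "card ?W \<le> card ?V")
proof -
  obtain P where P: "P \<in> carrier_mat m m" "P *\<^sub>v u = u" "P *\<^sub>v v = w"
    and sur: "\<And>y. y \<in> carrier_vec m \<Longrightarrow> \<exists>x\<in>carrier_vec m. P *\<^sub>v x = y"
    using shear_exists[OF u v w] by metis
  have AP: "(A * P) *\<^sub>v x = A *\<^sub>v (P *\<^sub>v x)" if "A \<in> carrier_mat l m" "x \<in> carrier_vec m" for A x
    using that P(1) by simp
  have "inj_on (\<lambda>A. A * P) ?W"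
  proof (rule inj_onI)
    fix A B assume "A \<in> ?W" "B \<in> ?W" and eq: "A * P = B * P"
    hence A: "A \<in> carrier_mat l m" "B \<in> carrier_mat l m" by (auto simp: full_rank_mats_iff)
    have *: "A *\<^sub>v y = B *\<^sub>v y" if "y \<in> carrier_vec m" for y
      using sur[OF that] AP A eq by metis
    show "A = B"
    proof (rule eq_matI)
      fix i j assume "i < dim_row B" "j < dim_col B"
      hence "i < l" "j < m" using A by simp_all
      thus "A $$ (i, j) = B $$ (i, j)"
        using arg_cong[OF *[of "unit_vec m j"], of "\<lambda>x. x $ i"] A by simp
    qed (use A in auto)
  qed
  moreover have "(\<lambda>A. A * P) ` ?W \<subseteq> ?V"
  proof (rule image_subsetI)
    fix A assume W: "A \<in> ?W"
    hence A: "A \<in> carrier_mat l m" and surA: "\<And>y. y \<in> carrier_vec l \<Longrightarrow> \<exists>x\<in>carrier_vec m. A *\<^sub>v x = y"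
      by (auto simp: full_rank_mats_iff)
    have "\<exists>x\<in>carrier_vec m. (A * P) *\<^sub>v x = y" if "y \<in> carrier_vec l" for y
      using surA[OF that] sur AP[OF A] by metis
    thus "A * P \<in> ?V"
      using W A P u v AP[OF A] by (auto simp: full_rank_mats_iff)
  qed
  moreover have "finite ?V"
    by (rule finite_subset[OF _ finite_carrier_mat[of l m]]) (auto simp: rank_mats_def)
  ultimately show ?thesis using card_inj_on_le by blast
qed

text \<open>
  All \<open>w\<close> outside the line through \<open>u\<close> have the same number of annihilators, so this number can be
  found by counting the pairs \<open>(A, w)\<close> with \<open>w\<close> in the kernel of \<open>A\<close> in two ways.
\<close>

lemma card_annihilators:
  fixes u v :: "'a::{field, finite} vec"
  assumes u: "u \<in> carrier_vec m" "u \<noteq> 0\<^sub>v m"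
    and v: "v \<in> carrier_vec m" "\<And>c. v \<noteq> c \<cdot>\<^sub>v u" and "l < m"
  shows "real (card {A \<in> rank_mats l m l. A *\<^sub>v u = 0\<^sub>v l \<and> A *\<^sub>v v = 0\<^sub>v l})
           * (real CARD('a) ^ m - real CARD('a))
         = real (card {A \<in> rank_mats l m l. A *\<^sub>v u = 0\<^sub>v l}) * (real CARD('a) ^ (m - l) - real CARD('a))"
proof -
  let ?q = "CARD('a)"
  define L where "L = range (\<lambda>c. c \<cdot>\<^sub>v u)"
  define R where "R = {A \<in> rank_mats l m l. A *\<^sub>v u = 0\<^sub>v l}"
  define W where "W = carrier_vec m - L"
  have R: "A \<in> rank_mats l m l" "A \<in> carrier_mat l m" "A *\<^sub>v u = 0\<^sub>v l" if "A \<in> R" for A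
    using that by (auto simp: R_def rank_mats_def)
  have finR: "finite R"
    by (rule finite_subset[OF _ finite_carrier_mat[of l m]]) (auto simp: R_def rank_mats_def)
  have finW: "finite W" by (simp add: W_def finite_carrier_vec)
  have subL: "L \<subseteq> carrier_vec m" using u by (auto simp: L_def)
  have finL: "finite L" by (simp add: L_def)
  have cardL: "card L = ?q"
  proof -
    obtain i where "i < m" "u $ i \<noteq> 0" using u by (auto simp: vec_eq_iff)
    hence "inj (\<lambda>c. c \<cdot>\<^sub>v u)"
      using u(1) by (intro injI) (metis carrier_vecD index_smult_vec(1) mult_right_cancel)
    thus ?thesis by (simp add: L_def card_image)
  qed
  have cardW: "real (card W) = real ?q ^ m - real ?q"
  proof -
    have "card W + card L = card (carrier_vec m :: 'a vec set)"
      unfolding W_def using card_Diff_subset[OF finL subL] card_mono[OF finite_carrier_vec subL] by simp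
    from arg_cong[OF this, of real] show ?thesis by (simp add: cardL card_carrier_vec)
  qed
  have ker: "real (card {w \<in> W. A *\<^sub>v w = 0\<^sub>v l}) = real ?q ^ (m - l) - real ?q" if A: "A \<in> R" for A
  proof -
    \<comment> \<open>The line \<open>L\<close> lies in the kernel of every \<open>A\<close> in
      \<open>R\<close>; removing its \<open>?q\<close> vectors leaves the stated number.\<close>
    have LK: "L \<subseteq> {x \<in> carrier_vec m. A *\<^sub>v x = 0\<^sub>v l}"
      using subL R[OF A] u by (auto simp: L_def mult_mat_vec)
    have "{w \<in> W. A *\<^sub>v w = 0\<^sub>v l} = {x \<in> carrier_vec m. A *\<^sub>v x = 0\<^sub>v l} - L" by (auto simp: W_def)
    hence "card {w \<in> W. A *\<^sub>v w = 0\<^sub>v l} + card L = ?q ^ (m - l)"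
      using card_kernel_full_rank[OF R(1)[OF A]] \<open>l < m\<close> card_Diff_subset[OF finL LK]
        card_mono[OF finite_subset[OF _ finite_carrier_vec[of m]] LK] by auto
    from arg_cong[OF this, of real] show ?thesis by (simp add: cardL)
  qed
  have const: "card {A \<in> R. A *\<^sub>v w = 0\<^sub>v l} = card {A \<in> R. A *\<^sub>v v = 0\<^sub>v l}" if "w \<in> W" for w
  proof -
    have w: "w \<in> carrier_vec m" "\<And>c. w \<noteq> c \<cdot>\<^sub>v u" using that by (auto simp: W_def L_def)
    show ?thesis
      using card_annihilators_le[OF u v w, of l] card_annihilators_le[OF u w v, of l]
      by (simp add: R_def conj_assoc)
  qed
  have "(\<Sum>w\<in>W. card {A \<in> R. A *\<^sub>v w = 0\<^sub>v l}) = (\<Sum>A\<in>R. card {w \<in> W. A *\<^sub>v w = 0\<^sub>v l})"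
    using finW finR by (rule sum_multicount_gen) simp
  from arg_cong[OF this, of real]
  have "real (card W) * card {A \<in> R. A *\<^sub>v v = 0\<^sub>v l} = card R * (real ?q ^ (m - l) - real ?q)"
    by (simp add: const ker)
  thus ?thesis by (simp add: cardW R_def conj_assoc mult.commute)
qed

text \<open>Uniform sampling of \<open>A\<close> needs a nonempty set. If \<open>u $ i\<close> is
  nonzero, the functionals \<open>x $ j - u $ j / u $ i * x $ i\<close> with \<open>j\<close>
  different from \<open>i\<close> are independent and vanish on \<open>u\<close>; there are
  \<open>m - 1\<close> of them, and \<open>l\<close> serve as rows.\<close>

lemma annihilator_exists:
  fixes u :: "'a::field vec"
  assumes u: "u \<in> carrier_vec m" "u \<noteq> 0\<^sub>v m" and "l < m"
  shows "{A \<in> rank_mats l m l. A *\<^sub>v u = 0\<^sub>v l} \<noteq> {}"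
proof -
  obtain i where i: "i < m" "u $ i \<noteq> 0" using u by (auto simp: vec_eq_iff)
  \<comment> \<open>\<open>s\<close> enumerates the coordinates while skipping \<open>i\<close>; its
    first \<open>l\<close> values stay below \<open>m\<close> because \<open>l < m\<close>.\<close>
  define s where "s k = (if k < i then k else Suc k)" for k
  have s: "s k < m" "s k \<noteq> i" if "k < l" for k using that \<open>l < m\<close> i by (auto simp: s_def)
  define r where "r k = unit_vec m (s k) - (u $ s k / u $ i) \<cdot>\<^sub>v unit_vec m i" for k
  define A where "A = mat_of_rows m (map r [0..<l])"
  have r: "r k \<in> carrier_vec m" for k by (simp add: r_def)
  have A: "A \<in> carrier_mat l m" unfolding A_def by (metis diff_zero length_map length_upt mat_of_rows_carrier(1))
  have Ax: "(A *\<^sub>v x) $ k = x $ s k - u $ s k / u $ i * x $ i" if x: "x \<in> carrier_vec m" and k: "k < l" for x k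
  proof -
    have "row A k = r k" unfolding A_def using k r by (subst mat_of_rows_row) auto
    hence "(A *\<^sub>v x) $ k = r k \<bullet> x" using A k by simp
    also have "\<dots> = unit_vec m (s k) \<bullet> x - ((u $ s k / u $ i) \<cdot>\<^sub>v unit_vec m i) \<bullet> x"
      unfolding r_def using x by (intro minus_scalar_prod_distrib) auto
    also have "\<dots> = x $ s k - u $ s k / u $ i * x $ i"
      using x s(1)[OF k] i by simp
    finally show ?thesis .
  qed
  have "A *\<^sub>v u = 0\<^sub>v l"
  proof (rule eq_vecI)
    fix k assume "k < dim_vec (0\<^sub>v l)"
    thus "(A *\<^sub>v u) $ k = 0\<^sub>v l $ k" using Ax[OF u(1), of k] i by simp
  qed (use A in simp)
  moreover have "\<exists>x\<in>carrier_vec m. A *\<^sub>v x = y" if y: "y \<in> carrier_vec l" for y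
  proof
    \<comment> \<open>The entries of \<open>y\<close> are placed at the coordinates
      \<open>s k\<close>, hence the shift by one beyond \<open>i\<close>. Coordinate
      \<open>i\<close> is 0, so the correction term in \<open>Ax\<close> vanishes.\<close>
    let ?x = "Matrix.vec m (\<lambda>j. if j = i then 0 else if j < i then (if j < l then y $ j else 0) else if j - 1 < l then y $ (j - 1) else 0)"
    show "A *\<^sub>v ?x = y"
    proof (rule eq_vecI)
      fix k assume "k < dim_vec y"
      hence k: "k < l" using y by simp
      show "(A *\<^sub>v ?x) $ k = y $ k"
        using s[OF k] i k by (subst Ax) (auto simp: s_def split: if_splits)
    qed (use A y in auto)
  qed simp
  ultimately show ?thesis using A by (auto simp: full_rank_mats_iff)
qed

subsection \<open>The expected number of solutions\<close>

text \<open>Columns are represented by lists so that \<open>permute_list\<close> and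
  \<open>mset\<close> apply to them.\<close>

definition list_column :: "'a list \<Rightarrow> 'a mat" where
  "list_column xs = Matrix.mat (length xs) 1 (\<lambda>(i, _). xs ! i)"

lemma rank_one_columns_eq:
  "rank_mats m 1 1 = list_column ` {xs :: 'a::field list. length xs = m \<and> xs \<noteq> replicate m 0}"
proof -
  have zero: "list_column xs = 0\<^sub>m m 1 \<longleftrightarrow> xs = replicate m 0" if "length xs = m" for xs :: "'a list"
  proof
    assume z: "list_column xs = 0\<^sub>m m 1"
    have "xs ! i = 0" if i: "i < m" for i
      using arg_cong[OF z, of "\<lambda>M. M $$ (i, 0)"] i \<open>length xs = m\<close> by (simp add: list_column_def)
    thus "xs = replicate m 0" using that by (intro nth_equalityI) auto
  next
    assume "xs = replicate m 0"
    thus "list_column xs = 0\<^sub>m m 1" by (intro eq_matI) (auto simp: list_column_def)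
  qed
  show ?thesis
  proof (intro equalityI subsetI)
    fix B :: "'a mat" assume "B \<in> rank_mats m 1 1"
    hence B: "B \<in> carrier_mat m 1" "B \<noteq> 0\<^sub>m m 1" unfolding rank_one_column_iff by blast+
    define xs where "xs = map (\<lambda>i. B $$ (i, 0)) [0..<m]"
    have "B = list_column xs" using B(1) by (intro eq_matI) (auto simp: list_column_def xs_def)
    moreover have "length xs = m" by (simp add: xs_def)
    ultimately show "B \<in> list_column ` {xs. length xs = m \<and> xs \<noteq> replicate m 0}"
      using zero[of xs] B(2) by blast
  next
    fix B :: "'a mat" assume "B \<in> list_column ` {xs. length xs = m \<and> xs \<noteq> replicate m 0}"
    then obtain xs where xs: "B = list_column xs" "length xs = m" "xs \<noteq> replicate m 0" by blast
    have "B \<in> carrier_mat m 1" using xs(1,2) by (simp add: list_column_def)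
    moreover have "B \<noteq> 0\<^sub>m m 1" unfolding xs(1) using zero[OF xs(2)] xs(3) by metis
    ultimately show "B \<in> rank_mats m 1 1" by (intro rank_one_column_iff[THEN iffD2] conjI)
  qed
qed

lemma inj_on_list_column: "inj_on list_column {xs. length xs = m}"
proof (rule inj_onI)
  fix xs ys :: "'a list" assume len: "xs \<in> {xs. length xs = m}" "ys \<in> {xs. length xs = m}"
    and eq: "list_column xs = list_column ys"
  have "xs ! i = ys ! i" if "i < m" for i
    using arg_cong[OF eq, of "\<lambda>M. M $$ (i, 0)"] that len by (simp add: list_column_def)
  thus "xs = ys" using len by (intro nth_equalityI) auto
qed

text \<open>Row \<open>i\<close> of \<open>permutation_mat m \<rho>\<close> picks entry
  \<open>\<rho> i\<close>, which is the convention of \<open>permute_list\<close>. The matrix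
  equation thus becomes a kernel condition on the permuted vector.\<close>

lemma mult_permutation_column_eq_0_iff:
  fixes A :: "'a::field mat"
  assumes A: "A \<in> carrier_mat l m" and len: "length xs = m" and \<rho>: "\<rho> permutes {..<m}"
  shows "A * permutation_mat m \<rho> * list_column xs = 0\<^sub>m l 1
         \<longleftrightarrow> A *\<^sub>v vec_of_list (permute_list \<rho> xs) = 0\<^sub>v l"
proof -
  define ys where "ys = permute_list \<rho> xs"
  have len': "length ys = m" by (simp add: ys_def len)
  have P: "permutation_mat m \<rho> \<in> carrier_mat m m" by (simp add: permutation_mat_def)
  have C: "list_column xs \<in> carrier_mat m 1" "list_column ys \<in> carrier_mat m 1"
    by (simp_all add: list_column_def len len')
  have \<rho>_less: "\<rho> i < m" if "i < m" for i using permutes_in_image[OF \<rho>, of i] that by simp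
  have "permutation_mat m \<rho> * list_column xs = list_column ys"
  proof (rule eq_matI)
    fix i j assume "i < dim_row (list_column ys)" "j < dim_col (list_column ys)"
    hence ij: "i < m" "j = 0" using C by auto
    have "(permutation_mat m \<rho> * list_column xs) $$ (i, 0) = (\<Sum>k<m. (if \<rho> i = k then 1 else 0) * xs ! k)"
      using ij P C by (simp add: permutation_mat_def list_column_def scalar_prod_def len atLeast0LessThan)
    also have "\<dots> = (\<Sum>k<m. if \<rho> i = k then xs ! k else 0)" by (intro sum.cong) auto
    also have "\<dots> = xs ! \<rho> i" using \<rho>_less[OF ij(1)] by simp
    also have "\<dots> = list_column ys $$ (i, 0)"
      using ij len' \<rho> len by (simp add: list_column_def ys_def permute_list_nth)
    finally show "(permutation_mat m \<rho> * list_column xs) $$ (i, j) = list_column ys $$ (i, j)" using ij by simp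
  qed (use P C in auto)
  hence eq: "A * permutation_mat m \<rho> * list_column xs = A * list_column ys"
    using assoc_mult_mat[OF A P C(1)] by simp
  have col: "col (list_column ys) 0 = vec_of_list ys"
    by (rule eq_vecI) (auto simp: list_column_def vec_of_list_index)
  have ent: "(A * list_column ys) $$ (i, 0) = (A *\<^sub>v vec_of_list ys) $ i" if "i < l" for i
    using that A C(2) by (simp flip: col)
  have v: "vec_of_list ys \<in> carrier_vec m" using len' by (simp add: carrier_vecI)
  show ?thesis unfolding eq ys_def[symmetric]
  proof
    assume *: "A * list_column ys = 0\<^sub>m l 1"
    show "A *\<^sub>v vec_of_list ys = 0\<^sub>v l"
    proof (rule eq_vecI)
      fix i assume "i < dim_vec (0\<^sub>v l :: 'a Matrix.vec)"
      thus "(A *\<^sub>v vec_of_list ys) $ i = 0\<^sub>v l $ i" using ent[of i] * by simp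
    qed (use A in simp)
  next
    assume *: "A *\<^sub>v vec_of_list ys = 0\<^sub>v l"
    show "A * list_column ys = 0\<^sub>m l 1"
    proof (rule eq_matI)
      fix i j assume "i < dim_row (0\<^sub>m l 1 :: 'a mat)" "j < dim_col (0\<^sub>m l 1 :: 'a mat)"
      thus "(A * list_column ys) $$ (i, j) = 0\<^sub>m l 1 $$ (i, j)" using ent[of i] * by simp
    qed (use A C in auto)
  qed
qed

text \<open>Right composition with \<open>\<pi>\<close> turns the permutations taking
  \<open>xs\<close> to \<open>c\<close> times \<open>xs\<close> into those taking it to
  \<open>c\<close> times \<open>permute_list \<pi> xs\<close>, so \<open>\<pi>\<close> drops out of
  the count. A nonzero entry of \<open>xs\<close> rules out \<open>c = 0\<close> and makes the
  classes of distinct \<open>c\<close> disjoint.\<close>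

lemma card_parallel_permutations:
  fixes xs :: "'a::{field, finite} list"
  assumes len: "length xs = m" and nz: "xs \<noteq> replicate m 0" and \<pi>: "\<pi> permutes {..<m}"
  shows "card {\<rho>. \<rho> permutes {..<m} \<and> (\<exists>c. permute_list \<rho> xs = map ((*) c) (permute_list \<pi> xs))}
         = (\<Sum>c\<in>UNIV - {0}. card {\<rho>. \<rho> permutes {..<m} \<and> permute_list \<rho> xs = map ((*) c) xs})"
proof -
  define ys where "ys = permute_list \<pi> xs"
  define T where "T c = {\<rho>. \<rho> permutes {..<m} \<and> permute_list \<rho> xs = map ((*) c) ys}" for c
  obtain x where x: "x \<in> set xs" "x \<noteq> 0"
    using nz len by (metis replicate_length_same)
  have xy: "x \<in> set ys" using x(1) \<pi> len by (simp add: ys_def)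
  have T0: "T 0 = {}"
  proof -
    have "x \<in> set (permute_list \<rho> xs)" if "\<rho> permutes {..<m}" for \<rho> using x(1) that len by simp
    moreover have "x \<notin> set (map ((*) 0) ys)" using x(2) by auto
    ultimately show ?thesis unfolding T_def by (metis (mono_tags, lifting) empty_Collect_eq)
  qed
  have fin: "finite (T c)" for c
    by (rule finite_subset[OF _ finite_permutations[of "{..<m}"]]) (auto simp: T_def)
  have disj: "T c \<inter> T d = {}" if "c \<noteq> d" for c d
  proof -
    have "map ((*) c) ys \<noteq> map ((*) d) ys" using xy x(2) that by (auto simp: map_eq_conv)
    thus ?thesis by (auto simp: T_def)
  qed
  have card_T: "card (T c) = card {\<rho>. \<rho> permutes {..<m} \<and> permute_list \<rho> xs = map ((*) c) xs}"
    (is "_ = card ?S") for c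
  proof -
    define \<pi>' where "\<pi>' = inv_into UNIV \<pi>"
    have \<pi>': "\<pi>' permutes {..<m}" unfolding \<pi>'_def using \<pi> by (rule permutes_inv)
    have inv: "\<pi> \<circ> \<pi>' = id" "\<pi>' \<circ> \<pi> = id"
      unfolding \<pi>'_def using permutes_inv_o[OF \<pi>] by auto
    have "permute_list \<pi>' ys = permute_list (\<pi> \<circ> \<pi>') xs"
      unfolding ys_def using \<pi>' len by (simp add: permute_list_compose)
    hence restore: "permute_list \<pi>' ys = xs" by (simp add: inv)
    have "bij_betw (\<lambda>\<rho>. \<rho> \<circ> \<pi>) ?S (T c)"
    proof (rule bij_betw_byWitness[where f' = "\<lambda>\<rho>. \<rho> \<circ> \<pi>'"])
      show "\<forall>\<rho>\<in>?S. (\<rho> \<circ> \<pi>) \<circ> \<pi>' = \<rho>" "\<forall>\<rho>\<in>T c. (\<rho> \<circ> \<pi>') \<circ> \<pi> = \<rho>"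
        by (auto simp: comp_assoc inv)
      show "(\<lambda>\<rho>. \<rho> \<circ> \<pi>) ` ?S \<subseteq> T c"
        using \<pi> len by (auto simp: T_def ys_def permute_list_compose permutes_compose permute_list_map)
      show "(\<lambda>\<rho>. \<rho> \<circ> \<pi>') ` T c \<subseteq> ?S"
      proof (intro image_subsetI CollectI conjI)
        fix \<rho> assume \<rho>: "\<rho> \<in> T c"
        show "\<rho> \<circ> \<pi>' permutes {..<m}" using \<rho> \<pi>' by (auto simp: T_def permutes_compose)
        have "permute_list (\<rho> \<circ> \<pi>') xs = permute_list \<pi>' (map ((*) c) ys)"
          using \<rho> \<pi>' len by (simp add: T_def permute_list_compose)
        also have "\<dots> = map ((*) c) xs"
          using \<pi>' len restore by (simp add: permute_list_map ys_def)
        finally show "permute_list (\<rho> \<circ> \<pi>') xs = map ((*) c) xs" .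
      qed
    qed
    thus ?thesis by (simp add: bij_betw_same_card)
  qed
  have "{\<rho>. \<rho> permutes {..<m} \<and> (\<exists>c. permute_list \<rho> xs = map ((*) c) ys)} = (\<Union>c\<in>UNIV - {0}. T c)"
  proof -
    have "(\<Union>c\<in>UNIV - {0}. T c) = (\<Union>c. T c)" using T0 by auto
    thus ?thesis by (auto simp: T_def)
  qed
  hence "card {\<rho>. \<rho> permutes {..<m} \<and> (\<exists>c. permute_list \<rho> xs = map ((*) c) ys)} = (\<Sum>c\<in>UNIV - {0}. card (T c))"
    using fin disj by (simp add: card_UN_disjoint)
  thus ?thesis by (simp only: ys_def card_T)
qed

text \<open>The sums over \<open>A\<close> and \<open>\<rho>\<close> are exchanged:
  \<open>\<rho>\<close> is a solution with probability 1 if it makes the column parallel to the one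
  permuted by \<open>\<pi>\<close>, and with probability \<open>p\<close> otherwise. The resulting
  mean is independent of \<open>\<pi>\<close>.\<close>

lemma mean_N_sol:
  fixes xs :: "'a::{field, finite} list"
  assumes len: "length xs = m" and nz: "xs \<noteq> replicate m 0" and \<pi>: "\<pi> permutes {..<m}" and l: "0 < l" "l < m"
  defines "p \<equiv> (real CARD('a) ^ (m - l) - real CARD('a)) / (real CARD('a) ^ m - real CARD('a))"
  defines "R \<equiv> {A \<in> rank_mats l m l. A * permutation_mat m \<pi> * list_column xs = 0\<^sub>m l 1}"
  shows "R \<noteq> {}" and "finite R"
    and "(\<Sum>A\<in>R. real (N_sol A (list_column xs))) / real (card R)
         = fact m * p + (1 - p) * (\<Sum>c\<in>UNIV - {0}. card {\<rho>. \<rho> permutes {..<m} \<and> permute_list \<rho> xs = map ((*) c) xs})"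
proof -
  let ?q = "real CARD('a)"
  define ys where "ys = permute_list \<pi> xs"
  define u where "u = vec_of_list ys"
  define S where "S = {\<rho>. \<rho> permutes {..<m}}"
  define v where "v \<rho> = vec_of_list (permute_list \<rho> xs)" for \<rho>
  have lenys: "length ys = m" by (simp add: ys_def len)
  have u: "u \<in> carrier_vec m" using lenys by (simp add: u_def carrier_vecI)
  have v: "v \<rho> \<in> carrier_vec m" for \<rho> using len by (simp add: v_def carrier_vecI)
  have R_eq: "R = {A \<in> rank_mats l m l. A *\<^sub>v u = 0\<^sub>v l}"
    unfolding R_def u_def ys_def
    using mult_permutation_column_eq_0_iff[OF _ len \<pi>] by (auto simp: rank_mats_def)
  have u0: "u \<noteq> 0\<^sub>v m"
  proof
    assume "u = 0\<^sub>v m"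
    hence "list_of_vec u ! i = 0" if "i < m" for i using that by (simp add: list_of_vec_index)
    hence "\<forall>y\<in>set ys. y = 0" using lenys by (auto simp: u_def list_vec in_set_conv_nth)
    hence "\<forall>x\<in>set xs. x = 0" using \<pi> len by (simp add: ys_def)
    thus False using nz len by (metis replicate_length_same)
  qed
  show ne: "R \<noteq> {}" unfolding R_eq using annihilator_exists[OF u u0 l(2)] .
  show fin: "finite R"
    by (rule finite_subset[OF _ finite_carrier_mat[of l m]]) (auto simp: R_def rank_mats_def)
  have R0: "card R > 0" using ne fin by (simp add: card_gt_0_iff)
  have finS: "finite S" by (simp add: S_def finite_permutations)
  have cardS: "card S = fact m" by (simp add: S_def card_permutations[of _ m])
  have "CARD('a) > 1" using card_mono[of UNIV "{0::'a, 1}"] by simp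
  \<comment> \<open>From \<open>0 < l\<close> and \<open>l < m\<close> follows \<open>m > 1\<close>,
    so the denominator of \<open>p\<close> is nonzero.\<close>
  hence q: "?q ^ m - ?q > 0"
    using power_strict_increasing[of 1 m ?q] l by simp
  have par: "(\<exists>c. v \<rho> = c \<cdot>\<^sub>v u) \<longleftrightarrow> (\<exists>c. permute_list \<rho> xs = map ((*) c) ys)" for \<rho>
  proof -
    have "c \<cdot>\<^sub>v u = vec_of_list (map ((*) c) ys)" for c
      by (rule eq_vecI) (auto simp: u_def vec_of_list_index)
    thus ?thesis unfolding v_def by (metis list_vec)
  qed
  have count: "real (card {A \<in> R. A *\<^sub>v v \<rho> = 0\<^sub>v l})
               = real (card R) * (if \<exists>c. v \<rho> = c \<cdot>\<^sub>v u then 1 else p)" for \<rho>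
  proof (cases "\<exists>c. v \<rho> = c \<cdot>\<^sub>v u")
    case True
    then obtain c where c: "v \<rho> = c \<cdot>\<^sub>v u" by blast
    have "A *\<^sub>v v \<rho> = 0\<^sub>v l" if "A \<in> R" for A
      using that u by (auto simp: c R_eq rank_mats_def mult_mat_vec)
    hence "{A \<in> R. A *\<^sub>v v \<rho> = 0\<^sub>v l} = R" by blast
    thus ?thesis using True by simp
  next
    case False
    hence "\<And>c. v \<rho> \<noteq> c \<cdot>\<^sub>v u" by blast
    from card_annihilators[OF u u0 v this l(2)]
    have "real (card {A \<in> R. A *\<^sub>v v \<rho> = 0\<^sub>v l}) * (?q ^ m - ?q) = card R * (?q ^ (m - l) - ?q)"
      by (simp add: R_eq conj_assoc)
    thus ?thesis using False q by (simp add: p_def field_simps)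
  qed
  have N: "N_sol A (list_column xs) = card {\<rho> \<in> S. A *\<^sub>v v \<rho> = 0\<^sub>v l}" if "A \<in> R" for A
  proof -
    have A: "A \<in> carrier_mat l m" using that by (simp add: R_def rank_mats_def)
    have "{\<rho> \<in> sym_group m. A * permutation_mat m \<rho> * list_column xs = 0\<^sub>m l 1} = {\<rho> \<in> S. A *\<^sub>v v \<rho> = 0\<^sub>v l}"
      unfolding sym_group_def S_def v_def atLeast0LessThan
      using mult_permutation_column_eq_0_iff[OF A len] by auto
    moreover have "dim_col A = m" "dim_row A = l" "dim_col (list_column xs) = 1"
      using A by (auto simp: list_column_def)
    ultimately show ?thesis by (simp add: N_sol_def)
  qed
  have "(\<Sum>A\<in>R. N_sol A (list_column xs)) = (\<Sum>A\<in>R. card {\<rho> \<in> S. A *\<^sub>v v \<rho> = 0\<^sub>v l})"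
    by (intro sum.cong refl N)
  also have "\<dots> = (\<Sum>\<rho>\<in>S. card {A \<in> R. A *\<^sub>v v \<rho> = 0\<^sub>v l})"
    using fin finS by (rule sum_multicount_gen) simp
  finally have "(\<Sum>A\<in>R. real (N_sol A (list_column xs))) = (\<Sum>\<rho>\<in>S. real (card {A \<in> R. A *\<^sub>v v \<rho> = 0\<^sub>v l}))"
    by (simp flip: of_nat_sum)
  also have "\<dots> = real (card R) * (\<Sum>\<rho>\<in>S. if \<exists>c. v \<rho> = c \<cdot>\<^sub>v u then 1 else p)"
    by (simp only: count sum_distrib_left)
  \<comment> \<open>Every permutation counts \<open>p\<close>, and the parallel ones count
    \<open>1 - p\<close> more.\<close>
  also have "(\<Sum>\<rho>\<in>S. if \<exists>c. v \<rho> = c \<cdot>\<^sub>v u then 1 else p) = (\<Sum>\<rho>\<in>S. p + (if \<exists>c. v \<rho> = c \<cdot>\<^sub>v u then 1 - p else 0))"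
    by (intro sum.cong) auto
  also have "\<dots> = fact m * p + (1 - p) * card {\<rho>\<in>S. \<exists>c. v \<rho> = c \<cdot>\<^sub>v u}"
    using finS by (simp add: sum.distrib cardS sum.inter_filter[symmetric] del: ex_simps)
  also have "{\<rho>\<in>S. \<exists>c. v \<rho> = c \<cdot>\<^sub>v u} = {\<rho>. \<rho> permutes {..<m} \<and> (\<exists>c. permute_list \<rho> xs = map ((*) c) (permute_list \<pi> xs))}"
    unfolding par S_def ys_def by simp
  also have "card \<dots> = (\<Sum>c\<in>UNIV - {0}. card {\<rho>. \<rho> permutes {..<m} \<and> permute_list \<rho> xs = map ((*) c) xs})"
    by (rule card_parallel_permutations[OF len nz \<pi>])
  finally show "(\<Sum>A\<in>R. real (N_sol A (list_column xs))) / real (card R)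
         = fact m * p + (1 - p) * (\<Sum>c\<in>UNIV - {0}. card {\<rho>. \<rho> permutes {..<m} \<and> permute_list \<rho> xs = map ((*) c) xs})"
    using R0 by simp
qed

text \<open>The zero list has to be removed from the count of eigenlists. Every permutation fits it
  for every \<open>c\<close>, so it accounts for \<open>fact m\<close> per scalar; over the
  \<open>CARD('a) - 1\<close> nonzero scalars this gives the correction
  \<open>- real CARD('a) + 1\<close>.\<close>

lemma sum_eigenlists:
  "(\<Sum>xs | length xs = m \<and> xs \<noteq> replicate m 0. \<Sum>c\<in>UNIV - {0 :: 'a::{field, finite}}.
      real (card {\<rho>. \<rho> permutes {..<m} \<and> permute_list \<rho> xs = map ((*) c) xs}))
   = fact m * ((\<Sum>d | d dvd CARD('a) - 1. real (totient d) * real ((CARD('a) + m - 1) div d choose (m div d)))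
               - real CARD('a) + 1)"
proof -
  define g where "g c xs = card {\<rho>. \<rho> permutes {..<m} \<and> permute_list \<rho> xs = map ((*) c) xs}" for c :: 'a and xs
  have fin: "finite {xs :: 'a list. length xs = m}"
    using finite_lists_length_eq[of "UNIV :: 'a set" m] by simp
  have g0: "g c (replicate m 0) = fact m" for c
  proof -
    have "permute_list \<rho> (replicate m 0) = map ((*) c) (replicate m 0)" if "\<rho> permutes {..<m}" for \<rho>
      using that permutes_in_image[OF that] by (intro nth_equalityI) (auto simp: permute_list_nth)
    hence "g c (replicate m 0) = card {\<rho>. \<rho> permutes {..<m}}"
      unfolding g_def by (intro arg_cong[of _ _ card]) blast
    thus ?thesis by (simp add: card_permutations[of _ m])
  qed
  have inner: "(\<Sum>xs | length xs = m \<and> xs \<noteq> replicate m 0. real (g c xs))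
       = fact m * (real (card {M. size M = m \<and> image_mset ((*) c) M = M}) - 1)" for c
  proof -
    have "(\<Sum>xs | length xs = m. g c xs) = fact m * card {M. size M = m \<and> image_mset ((*) c) M = M}"
      unfolding g_def by (rule card_permutation_eigenlists)
    from arg_cong[OF this, of real]
    have "(\<Sum>xs | length xs = m. real (g c xs)) = fact m * real (card {M. size M = m \<and> image_mset ((*) c) M = M})"
      by simp
    moreover have "(\<Sum>xs | length xs = m. real (g c xs)) = real (g c (replicate m 0)) + (\<Sum>xs \<in> {xs. length xs = m} - {replicate m 0}. real (g c xs))"
      using fin by (intro sum.remove) auto
    moreover have "{xs. length xs = m} - {replicate m (0::'a)} = {xs. length xs = m \<and> xs \<noteq> replicate m 0}" by blast
    ultimately show ?thesis by (simp add: g0 algebra_simps)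
  qed
  have "(\<Sum>xs | length xs = m \<and> xs \<noteq> replicate m 0. \<Sum>c\<in>UNIV - {0}. real (g c xs))
        = (\<Sum>c\<in>UNIV - {0::'a}. fact m * (real (card {M. size M = m \<and> image_mset ((*) c) M = M}) - 1))"
    by (subst sum.swap) (intro sum.cong refl inner)
  also have "\<dots> = fact m * (real (\<Sum>c\<in>UNIV - {0::'a}. card {M. size M = m \<and> image_mset ((*) c) M = M}) - real (CARD('a) - 1))"
    by (simp add: sum_distrib_left[symmetric] sum_subtractf)
  also have "real (CARD('a) - 1) = real CARD('a) - 1"
    by (simp add: of_nat_diff Suc_le_eq)
  finally show ?thesis by (simp add: g_def sum_card_invariant_multisets algebra_simps)
qed

theorem theorem3:
  fixes q l m :: nat
  assumes "CARD('a::{field, finite}) = q"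
    and "0 < l" and "l < m"
  shows "measure_pmf.expectation
           (GenPKP l m 1 :: ('a mat \<times> 'a mat \<times> (nat \<Rightarrow> nat)) pmf)
           (\<lambda>(A, B, \<pi>). real (N_sol A B))
         = fact m * (real q ^ (m - l) - real q) / (real q ^ m - real q)
           + fact m * (real q ^ m - real q ^ (m - l)) / ((real q ^ m - 1) * (real q ^ m - real q))
             * ((\<Sum>d | d dvd q - 1. real (totient d) * real (((q + m - 1) div d) choose (m div d)))
                - real q + 1)"
proof -
  let ?q = "real q"
  let ?h = "\<lambda>(A :: 'a mat, B :: 'a mat, \<pi> :: nat \<Rightarrow> nat). real (N_sol A B)"
  define L where "L = {xs :: 'a list. length xs = m \<and> xs \<noteq> replicate m 0}"
  define R where "R \<pi> B = {A \<in> rank_mats l m l. A * permutation_mat m \<pi> * B = 0\<^sub>m l 1}" for \<pi> and B :: "'a mat"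
  define E where "E xs = (\<Sum>c\<in>UNIV - {0}. card {\<rho>. \<rho> permutes {..<m} \<and> permute_list \<rho> xs = map ((*) c) xs})" for xs :: "'a list"
  define p where "p = (?q ^ (m - l) - ?q) / (?q ^ m - ?q)"
  define X where "X = (\<Sum>d | d dvd q - 1. real (totient d) * real (((q + m - 1) div d) choose (m div d))) - ?q + 1"
  have "CARD('a) > 1" using card_mono[of UNIV "{0::'a, 1}"] by simp
  hence q1: "q > 1" using assms(1) by simp
  have q: "?q ^ m - ?q > 0"
    using power_strict_increasing[of 1 m ?q] assms q1 by simp
  have q': "?q ^ m - 1 > 0" using one_less_power[of ?q m] q1 assms by simp
  have finL: "finite L"
    using finite_subset[OF _ finite_lists_length_eq[of "UNIV :: 'a set" m], of L] by (auto simp: L_def)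
  have cardL: "real (card L) = ?q ^ m - 1"
  proof -
    have fin: "finite {xs :: 'a list. length xs = m}"
      using finite_lists_length_eq[of "UNIV :: 'a set" m] by simp
    have "L = {xs. length xs = m} - {replicate m 0}" by (auto simp: L_def)
    hence "card L = q ^ m - 1"
      using card_lists_length_eq[of "UNIV :: 'a set" m] assms(1) fin by (simp add: card_Diff_subset)
    thus ?thesis using q1 by (simp add: of_nat_diff)
  qed
  have neL: "L \<noteq> {}" using cardL q' by auto
  have sym: "sym_group m = {\<pi>. \<pi> permutes {..<m}}" by (simp add: sym_group_def atLeast0LessThan)
  have finS: "finite (sym_group m)" by (simp add: sym finite_permutations)
  have cardS: "card (sym_group m) = fact m" by (simp add: sym card_permutations[of _ m])
  have neS: "sym_group m \<noteq> {}" using cardS by auto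
  have ranks: "rank_mats m 1 1 = list_column ` L" unfolding L_def by (rule rank_one_columns_eq)
  note ranks' = ranks[unfolded One_nat_def]
  have ne_ranks: "rank_mats m 1 1 \<noteq> ({} :: 'a mat set)" and fin_ranks: "finite (rank_mats m 1 1 :: 'a mat set)"
    using neL finL by (simp_all add: ranks')
  have inj: "inj_on list_column L" using inj_on_list_column[of m] by (rule inj_on_subset) (auto simp: L_def)
  have R: "R \<pi> (list_column xs) \<noteq> {}" "finite (R \<pi> (list_column xs))"
    "(\<Sum>A\<in>R \<pi> (list_column xs). real (N_sol A (list_column xs))) / real (card (R \<pi> (list_column xs)))
     = fact m * p + (1 - p) * real (E xs)"
    if "\<pi> \<in> sym_group m" "xs \<in> L" for \<pi> xs
    using mean_N_sol[of xs m \<pi> l] that assms(2,3)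
    unfolding R_def E_def p_def L_def sym assms(1)[symmetric] by auto
  \<comment> \<open>Finite supports let the expectation of a mixture be computed as a finite
    average, one sampling stage at a time.\<close>
  have fin_inner: "finite (set_pmf (bind_pmf (pmf_of_set (R \<pi> B)) (\<lambda>A. return_pmf (A, B, \<pi>))))"
    if "\<pi> \<in> sym_group m" "B \<in> rank_mats m 1 1" for \<pi> B
    using R(1,2)[OF that(1)] that(2) by (auto simp: ranks ranks' set_pmf_of_set)
  have inner: "measure_pmf.expectation (bind_pmf (pmf_of_set (R \<pi> B)) (\<lambda>A. return_pmf (A, B, \<pi>))) ?h
      = (\<Sum>A\<in>R \<pi> B. real (N_sol A B)) / real (card (R \<pi> B))"
    if "\<pi> \<in> sym_group m" "B \<in> rank_mats m 1 1" for \<pi> B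
  proof -
    have "R \<pi> B \<noteq> {}" "finite (R \<pi> B)" using R(1,2)[OF that(1)] that(2) by (auto simp: ranks ranks')
    thus ?thesis
      by (subst pmf_expectation_bind_pmf_of_set) (simp_all add: sum_distrib_left divide_inverse mult.commute)
  qed
  have fin_middle: "finite (set_pmf (bind_pmf (pmf_of_set (rank_mats m 1 1))
        (\<lambda>B. bind_pmf (pmf_of_set (R \<pi> B)) (\<lambda>A. return_pmf (A, B, \<pi>)))))"
    if \<pi>: "\<pi> \<in> sym_group m" for \<pi>
    by (subst set_bind_pmf, subst set_pmf_of_set[OF ne_ranks fin_ranks])
       (rule finite_UN_I[OF fin_ranks fin_inner[OF \<pi>]])
  \<comment> \<open>The average over the \<open>q ^ m - 1\<close> nonzero columns. It has the same
    value for every \<open>\<pi>\<close>, so the outermost average leaves it unchanged.\<close>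
  have middle: "measure_pmf.expectation (bind_pmf (pmf_of_set (rank_mats m 1 1))
        (\<lambda>B. bind_pmf (pmf_of_set (R \<pi> B)) (\<lambda>A. return_pmf (A, B, \<pi>)))) ?h
      = fact m * p + (1 - p) * (fact m * X) / (?q ^ m - 1)"
    if \<pi>: "\<pi> \<in> sym_group m" for \<pi>
  proof -
    have "measure_pmf.expectation (bind_pmf (pmf_of_set (rank_mats m 1 1))
        (\<lambda>B. bind_pmf (pmf_of_set (R \<pi> B)) (\<lambda>A. return_pmf (A, B, \<pi>)))) ?h
      = (\<Sum>B\<in>rank_mats m 1 1. (\<Sum>A\<in>R \<pi> B. real (N_sol A B)) / real (card (R \<pi> B)) /\<^sub>R real (card (rank_mats m 1 1 :: 'a mat set)))"
      by (subst pmf_expectation_bind_pmf_of_set[OF ne_ranks fin_ranks fin_inner[OF \<pi>]], assumption)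
         (intro sum.cong refl, simp only: inner[OF \<pi>])
    also have "\<dots> = (\<Sum>B\<in>list_column ` L. (\<Sum>A\<in>R \<pi> B. real (N_sol A B)) / real (card (R \<pi> B))) / (?q ^ m - 1)"
      unfolding ranks card_image[OF inj] cardL
      by (simp add: divide_inverse sum_distrib_left mult.commute)
    also have "\<dots> = (\<Sum>xs\<in>L. fact m * p + (1 - p) * real (E xs)) / (?q ^ m - 1)"
      by (subst sum.reindex[OF inj]) (simp add: R(3)[OF \<pi>])
    also have "\<dots> = ((?q ^ m - 1) * (fact m * p) + (1 - p) * (\<Sum>xs\<in>L. real (E xs))) / (?q ^ m - 1)"
      by (simp add: sum.distrib cardL sum_distrib_left)
    also have "(\<Sum>xs\<in>L. real (E xs)) = fact m * X"
      using sum_eigenlists[of m, where 'a = 'a] by (simp add: E_def L_def X_def assms(1))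
    finally show ?thesis using q' by (simp add: add_divide_distrib)
  qed
  have "measure_pmf.expectation (GenPKP l m 1 :: ('a mat \<times> 'a mat \<times> (nat \<Rightarrow> nat)) pmf) ?h
      = (\<Sum>\<pi>\<in>sym_group m. (fact m * p + (1 - p) * (fact m * X) / (?q ^ m - 1)) /\<^sub>R real (card (sym_group m)))"
    unfolding GenPKP_def R_def[symmetric]
    by (subst pmf_expectation_bind_pmf_of_set[OF neS finS fin_middle], assumption)
       (intro sum.cong refl, simp only: middle)
  also have "\<dots> = fact m * p + (1 - p) * (fact m * X) / (?q ^ m - 1)"
    by (simp add: cardS)
  \<comment> \<open>The excess weight of the parallel permutations becomes the coefficient of the
    divisor sum.\<close>
  also have "1 - p = (?q ^ m - ?q ^ (m - l)) / (?q ^ m - ?q)"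
    using q by (simp add: p_def field_simps)
  finally show ?thesis by (simp add: p_def X_def mult_ac)
qed

end
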